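(* There are no finitely generated mixed-identity-free (MIF) groups of bounded MIF growth. Indeed, for any MIF group $\Gamma$ generated by a finite set $S$, there exists a constant $c>0$ such that $\mathcal{M}_{\Gamma}(l) \geq c \log (l)$ for all $l\in\mathbb{N}$, where $\mathcal M_\Gamma$ is the MIF growth function of $\Gamma$ with respect to $S$.
   Context: $\mathbb{N}=\{1,2,\dots\}$. Let $\Gamma$ be a group with finite generating set $S$, $|\cdot|_S$ its word length, and $\mathbb Z=\langle x\rangle$ an infinite cyclic group. For $w\in\Gamma*\langle x\rangle$ and $g\in\Gamma$, $w(g)$ denotes the image of $w$ under the homomorphism $\Gamma*\langle x\rangle\to\Gamma$ that is the identity on $\Gamma$ and sends $x\mapsto g$. A mixed identity for $\Gamma$ is a nontrivial $w\in\Gamma*\langle x\rangle$ with $w(g)=e$ for all $g\in\Gamma$; $\Gamma$ is mixed-identity-free (MIF) if it has none (replacing $\langle x\rangle$ by a free group $F_k$ of higher rank gives an equivalent notion). For $\Gamma$ MIF, the complexity of a nontrivial $w$ is $\min\{|g|_S : g\in\Gamma,\ w(g)\ne e\}$, and $\mathcal M_\Gamma(l)$ is the maximal complexity over nontrivial $w\in\Gamma*\langle x\rangle$ of word length at most $l$ with respect to the generating set $S\cup\{x\}$. *)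

theory Defs
  imports Complex_Main "HOL-Algebra.Elementary_Groups"
begin

section \<open>Free products of two groups\<close>

text \<open>
  The free product is the set of words in the disjoint union of the two carriers, modulo the
  congruence generated by multiplying adjacent letters of the same factor and deleting identities.
\<close>

abbreviation free_product_words ::
    "('a, 'm) monoid_scheme \<Rightarrow> ('b, 'n) monoid_scheme \<Rightarrow> ('a + 'b) list set" where
  "free_product_words G H \<equiv> lists (carrier G <+> carrier H)"

inductive_set free_product_rel ::
    "('a, 'm) monoid_scheme \<Rightarrow> ('b, 'n) monoid_scheme \<Rightarrow> (('a + 'b) list \<times> ('a + 'b) list) set"
  for G H where
  refl: "u \<in> free_product_words G H \<Longrightarrow> (u, u) \<in> free_product_rel G H"
| sym: "(u, v) \<in> free_product_rel G H \<Longrightarrow> (v, u) \<in> free_product_rel G H"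
| trans: "(u, v) \<in> free_product_rel G H \<Longrightarrow> (v, w) \<in> free_product_rel G H
    \<Longrightarrow> (u, w) \<in> free_product_rel G H"
| one_left: "u \<in> free_product_words G H \<Longrightarrow> v \<in> free_product_words G H
    \<Longrightarrow> (u @ [Inl \<one>\<^bsub>G\<^esub>] @ v, u @ v) \<in> free_product_rel G H"
| one_right: "u \<in> free_product_words G H \<Longrightarrow> v \<in> free_product_words G H
    \<Longrightarrow> (u @ [Inr \<one>\<^bsub>H\<^esub>] @ v, u @ v) \<in> free_product_rel G H"
| mult_left: "u \<in> free_product_words G H \<Longrightarrow> v \<in> free_product_words G H
    \<Longrightarrow> a \<in> carrier G \<Longrightarrow> b \<in> carrier G
    \<Longrightarrow> (u @ [Inl a, Inl b] @ v, u @ [Inl (a \<otimes>\<^bsub>G\<^esub> b)] @ v) \<in> free_product_rel G H"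
| mult_right: "u \<in> free_product_words G H \<Longrightarrow> v \<in> free_product_words G H
    \<Longrightarrow> a \<in> carrier H \<Longrightarrow> b \<in> carrier H
    \<Longrightarrow> (u @ [Inr a, Inr b] @ v, u @ [Inr (a \<otimes>\<^bsub>H\<^esub> b)] @ v) \<in> free_product_rel G H"

definition free_product ::
    "('a, 'm) monoid_scheme \<Rightarrow> ('b, 'n) monoid_scheme \<Rightarrow> ('a + 'b) list set monoid" where
  "free_product G H =
    \<lparr>carrier = free_product_words G H // free_product_rel G H,
     monoid.mult = (\<lambda>X Y. \<Union>u\<in>X. \<Union>v\<in>Y. free_product_rel G H `` {u @ v}),
     one = free_product_rel G H `` {[]}\<rparr>"

definition free_product_inl ::
    "('a, 'm) monoid_scheme \<Rightarrow> ('b, 'n) monoid_scheme \<Rightarrow> 'a \<Rightarrow> ('a + 'b) list set" where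
  "free_product_inl G H a = free_product_rel G H `` {[Inl a]}"

definition free_product_inr ::
    "('a, 'm) monoid_scheme \<Rightarrow> ('b, 'n) monoid_scheme \<Rightarrow> 'b \<Rightarrow> ('a + 'b) list set" where
  "free_product_inr G H b = free_product_rel G H `` {[Inr b]}"

definition word_value ::
    "('c, 'k) monoid_scheme \<Rightarrow> ('a \<Rightarrow> 'c) \<Rightarrow> ('b \<Rightarrow> 'c) \<Rightarrow> ('a + 'b) list \<Rightarrow> 'c" where
  "word_value K f h u = foldr (\<lambda>s y. case_sum f h s \<otimes>\<^bsub>K\<^esub> y) u \<one>\<^bsub>K\<^esub>"

text \<open>
  The homomorphism out of the free product induced by homomorphisms on the two factors; the words
  in one class all have the same value, see \<open>word_value_respects\<close> below.
\<close>

definition free_product_lift ::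
    "('c, 'k) monoid_scheme \<Rightarrow> ('a \<Rightarrow> 'c) \<Rightarrow> ('b \<Rightarrow> 'c) \<Rightarrow> ('a + 'b) list set \<Rightarrow> 'c" where
  "free_product_lift K f h X = the_elem (word_value K f h ` X)"


section \<open>Word length and mixed identities\<close>

definition word_length :: "('a, 'm) monoid_scheme \<Rightarrow> 'a set \<Rightarrow> 'a \<Rightarrow> nat" where
  "word_length G S g =
    (LEAST n. \<exists>u. length u = n \<and> set u \<subseteq> S \<union> (\<lambda>s. inv\<^bsub>G\<^esub> s) ` S \<and>
       foldr (\<lambda>s y. s \<otimes>\<^bsub>G\<^esub> y) u \<one>\<^bsub>G\<^esub> = g)"

text \<open>The infinite cyclic group is \<^const>\<open>integer_group\<close>, with generator \<open>1\<close> in the role of \<open>x\<close>.\<close>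

abbreviation adjoin_x :: "('a, 'm) monoid_scheme \<Rightarrow> ('a + int) list set monoid" where
  "adjoin_x G \<equiv> free_product G integer_group"

definition indet :: "('a, 'm) monoid_scheme \<Rightarrow> ('a + int) list set" where
  "indet G = free_product_inr G integer_group 1"

definition subst_x :: "('a, 'm) monoid_scheme \<Rightarrow> ('a + int) list set \<Rightarrow> 'a \<Rightarrow> 'a" where
  "subst_x G w g = free_product_lift G (\<lambda>a. a) (\<lambda>n::int. g [^]\<^bsub>G\<^esub> n) w"

definition mixed_identity :: "('a, 'm) monoid_scheme \<Rightarrow> ('a + int) list set \<Rightarrow> bool" where
  "mixed_identity G w \<longleftrightarrow>
    w \<in> carrier (adjoin_x G) \<and> w \<noteq> \<one>\<^bsub>adjoin_x G\<^esub> \<and> (\<forall>g\<in>carrier G. subst_x G w g = \<one>\<^bsub>G\<^esub>)"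

definition mixed_identity_free :: "('a, 'm) monoid_scheme \<Rightarrow> bool" where
  "mixed_identity_free G \<longleftrightarrow> \<not> (\<exists>w. mixed_identity G w)"

definition complexity :: "('a, 'm) monoid_scheme \<Rightarrow> 'a set \<Rightarrow> ('a + int) list set \<Rightarrow> nat" where
  "complexity G S w =
    (LEAST n. \<exists>g\<in>carrier G. subst_x G w g \<noteq> \<one>\<^bsub>G\<^esub> \<and> word_length G S g = n)"

definition MIF_gens :: "('a, 'm) monoid_scheme \<Rightarrow> 'a set \<Rightarrow> ('a + int) list set set" where
  "MIF_gens G S = insert (indet G) (free_product_inl G integer_group ` S)"

text \<open>
  For finite \<open>S\<close> generating \<open>G\<close> and \<open>l \<ge> 1\<close> the maximum is over a finite nonempty set, see
  \<open>MIF_ball\<close> below.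
\<close>

definition MIF_growth :: "('a, 'm) monoid_scheme \<Rightarrow> 'a set \<Rightarrow> nat \<Rightarrow> nat" where
  "MIF_growth G S l =
    Max {complexity G S w | w. w \<in> carrier (adjoin_x G) \<and> w \<noteq> \<one>\<^bsub>adjoin_x G\<^esub> \<and>
           word_length (adjoin_x G) (MIF_gens G S) w \<le> l}"


section \<open>The free product is a group with the universal property\<close>

lemma free_product_rel_words:
  assumes "group G" "group H" "(u, v) \<in> free_product_rel G H"
  shows "u \<in> free_product_words G H \<and> v \<in> free_product_words G H"
proof -
  interpret G: group G by fact
  interpret H: group H by fact
  show ?thesis using assms(3) by induction auto
qed

lemma equiv_free_product_rel:
  assumes "group G" "group H"
  shows "equiv (free_product_words G H) (free_product_rel G H)"
proof (rule equivI)
  show "refl_on (free_product_words G H) (free_product_rel G H)"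
    using free_product_rel.refl by (auto simp: refl_on_def)
  show "free_product_rel G H \<subseteq> free_product_words G H \<times> free_product_words G H"
    by (intro subsetI) (metis free_product_rel_words[OF assms] mem_Sigma_iff surj_pair)
  show "Relation.sym (free_product_rel G H)"
    using free_product_rel.sym by (auto simp: sym_def)
  show "Relation.trans (free_product_rel G H)"
    using free_product_rel.trans unfolding trans_def by blast
qed

lemma free_product_rel_context:
  assumes "(u, v) \<in> free_product_rel G H"
    and p: "p \<in> free_product_words G H" and q: "q \<in> free_product_words G H"
  shows "(p @ u @ q, p @ v @ q) \<in> free_product_rel G H"
  using assms(1)
proof induction
  case (refl u)
  then show ?case using p q by (intro free_product_rel.refl) auto
next
  case (sym u v)
  show ?case by (rule free_product_rel.sym[OF sym.IH])
next
  case (trans u v w)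
  then show ?case by (blast intro: free_product_rel.trans)
next
  case (one_left u v)
  then show ?case using free_product_rel.one_left[of "p @ u" G H "v @ q"] p q by simp
next
  case (one_right u v)
  then show ?case using free_product_rel.one_right[of "p @ u" G H "v @ q"] p q by simp
next
  case (mult_left u v a b)
  then show ?case using free_product_rel.mult_left[of "p @ u" G H "v @ q" a b] p q by simp
next
  case (mult_right u v a b)
  then show ?case using free_product_rel.mult_right[of "p @ u" G H "v @ q" a b] p q by simp
qed

locale two_groups =
  fixes G :: "('a, 'm) monoid_scheme" and H :: "('b, 'n) monoid_scheme"
  assumes grp_left: "group G" and grp_right: "group H"
begin

abbreviation W where "W \<equiv> free_product_words G H"
abbreviation R where "R \<equiv> free_product_rel G H"
abbreviation P where "P \<equiv> free_product G H"

sublocale left: group G by (rule grp_left)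
sublocale right: group H by (rule grp_right)

lemmas equiv_R = equiv_free_product_rel[OF grp_left grp_right]

lemma carrier_P: "carrier P = W // R"
  by (simp add: free_product_def)

lemma class_in_carrier: "u \<in> W \<Longrightarrow> R `` {u} \<in> carrier P"
  by (simp add: carrier_P quotientI)

lemma carrierE:
  assumes "X \<in> carrier P"
  obtains u where "u \<in> W" "X = R `` {u}"
  using assms unfolding carrier_P by (rule quotientE)

lemma class_eq_iff: "u \<in> W \<Longrightarrow> v \<in> W \<Longrightarrow> R `` {u} = R `` {v} \<longleftrightarrow> (u, v) \<in> R"
  using eq_equiv_class_iff[OF equiv_R] by blast

lemma one_P: "\<one>\<^bsub>P\<^esub> = R `` {[]}"
  by (simp add: free_product_def)

lemma append_cong:
  assumes "(u, u') \<in> R" "(v, v') \<in> R"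
  shows "(u @ v, u' @ v') \<in> R"
proof -
  note W = free_product_rel_words[OF grp_left grp_right]
  have "(u @ v, u' @ v) \<in> R"
    using free_product_rel_context[OF assms(1), of "[]" v] W[OF assms(2)] by simp
  moreover have "(u' @ v, u' @ v') \<in> R"
    using free_product_rel_context[OF assms(2), of u' "[]"] W[OF assms(1)] by simp
  ultimately show ?thesis by (rule free_product_rel.trans)
qed

lemma mult_P:
  assumes "u \<in> W" "v \<in> W"
  shows "R `` {u} \<otimes>\<^bsub>P\<^esub> R `` {v} = R `` {u @ v}"
proof -
  have "congruent2 R R (\<lambda>u v. R `` {u @ v})"
  proof (rule congruent2I')
    fix u u' v v' assume "(u, u') \<in> R" "(v, v') \<in> R"
    then show "R `` {u @ v} = R `` {u' @ v'}"
      using equiv_class_eq[OF equiv_R append_cong] by blast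
  qed
  from UN_equiv_class2[OF equiv_R equiv_R this assms] show ?thesis
    by (simp add: free_product_def)
qed

lemma letter_inverse:
  assumes "s \<in> carrier G <+> carrier H"
  obtains t where "t \<in> carrier G <+> carrier H" "([t, s], []) \<in> R"
  using assms
proof (cases s)
  case (Inl a)
  with assms have a: "a \<in> carrier G" by auto
  show ?thesis
  proof (rule that[of "Inl (inv\<^bsub>G\<^esub> a)"])
    show "Inl (inv\<^bsub>G\<^esub> a) \<in> carrier G <+> carrier H" using a by auto
    show "([Inl (inv\<^bsub>G\<^esub> a), s], []) \<in> R"
      using free_product_rel.trans[OF free_product_rel.mult_left[of "[]" G H "[]" "inv\<^bsub>G\<^esub> a" a]]
        free_product_rel.one_left[of "[]" G H "[]"] a Inl by auto
  qed
next
  case (Inr a)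
  with assms have a: "a \<in> carrier H" by auto
  show ?thesis
  proof (rule that[of "Inr (inv\<^bsub>H\<^esub> a)"])
    show "Inr (inv\<^bsub>H\<^esub> a) \<in> carrier G <+> carrier H" using a by auto
    show "([Inr (inv\<^bsub>H\<^esub> a), s], []) \<in> R"
      using free_product_rel.trans[OF free_product_rel.mult_right[of "[]" G H "[]" "inv\<^bsub>H\<^esub> a" a]]
        free_product_rel.one_right[of "[]" G H "[]"] a Inr by auto
  qed
qed

lemma word_inverse: "u \<in> W \<Longrightarrow> \<exists>v\<in>W. (v @ u, []) \<in> R"
proof (induction u)
  case Nil
  then show ?case using free_product_rel.refl[of "[]"] by force
next
  case (Cons s u)
  then obtain v where v: "v \<in> W" "(v @ u, []) \<in> R" by auto
  obtain t where t: "t \<in> carrier G <+> carrier H" "([t, s], []) \<in> R"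
    using letter_inverse Cons.prems by auto
  have "(v @ [t, s] @ u, v @ [] @ u) \<in> R"
    using free_product_rel_context[OF t(2)] v(1) Cons.prems by auto
  then have "((v @ [t]) @ s # u, []) \<in> R"
    using free_product_rel.trans v(2) by fastforce
  moreover have "v @ [t] \<in> W" using v t by auto
  ultimately show ?case by blast
qed

lemma group_P: "group P"
proof (rule groupI)
  fix X Y assume "X \<in> carrier P" "Y \<in> carrier P"
  then show "X \<otimes>\<^bsub>P\<^esub> Y \<in> carrier P"
    by (elim carrierE) (auto simp: mult_P intro!: class_in_carrier)
next
  show "\<one>\<^bsub>P\<^esub> \<in> carrier P" by (simp add: one_P class_in_carrier)
next
  fix X Y Z assume "X \<in> carrier P" "Y \<in> carrier P" "Z \<in> carrier P"
  then show "X \<otimes>\<^bsub>P\<^esub> Y \<otimes>\<^bsub>P\<^esub> Z = X \<otimes>\<^bsub>P\<^esub> (Y \<otimes>\<^bsub>P\<^esub> Z)"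
    by (elim carrierE) (simp add: mult_P)
next
  fix X assume "X \<in> carrier P"
  then show "\<one>\<^bsub>P\<^esub> \<otimes>\<^bsub>P\<^esub> X = X"
    by (elim carrierE) (simp add: mult_P one_P)
next
  fix X assume "X \<in> carrier P"
  then obtain u where u: "u \<in> W" "X = R `` {u}" by (rule carrierE)
  obtain v where v: "v \<in> W" "(v @ u, []) \<in> R" using word_inverse u by blast
  have "R `` {v} \<otimes>\<^bsub>P\<^esub> X = \<one>\<^bsub>P\<^esub>"
    using equiv_class_eq[OF equiv_R v(2)] u v by (simp add: mult_P one_P)
  then show "\<exists>Y\<in>carrier P. Y \<otimes>\<^bsub>P\<^esub> X = \<one>\<^bsub>P\<^esub>"
    using class_in_carrier v(1) by blast
qed

lemma inl_hom: "free_product_inl G H \<in> hom G P"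
proof (rule homI)
  fix a b assume ab: "a \<in> carrier G" "b \<in> carrier G"
  show "free_product_inl G H a \<in> carrier P"
    using ab by (auto simp: free_product_inl_def intro!: class_in_carrier)
  have "([Inl a, Inl b], [Inl (a \<otimes>\<^bsub>G\<^esub> b)]) \<in> R"
    using free_product_rel.mult_left[of "[]" G H "[]" a b] ab by simp
  then show "free_product_inl G H (a \<otimes>\<^bsub>G\<^esub> b) = free_product_inl G H a \<otimes>\<^bsub>P\<^esub> free_product_inl G H b"
    using equiv_class_eq[OF equiv_R] ab by (simp add: free_product_inl_def mult_P InlI)
qed

lemma inr_hom: "free_product_inr G H \<in> hom H P"
proof (rule homI)
  fix a b assume ab: "a \<in> carrier H" "b \<in> carrier H"
  show "free_product_inr G H a \<in> carrier P"
    using ab by (auto simp: free_product_inr_def intro!: class_in_carrier)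
  have "([Inr a, Inr b], [Inr (a \<otimes>\<^bsub>H\<^esub> b)]) \<in> R"
    using free_product_rel.mult_right[of "[]" G H "[]" a b] ab by simp
  then show "free_product_inr G H (a \<otimes>\<^bsub>H\<^esub> b) = free_product_inr G H a \<otimes>\<^bsub>P\<^esub> free_product_inr G H b"
    using equiv_class_eq[OF equiv_R] ab by (simp add: free_product_inr_def mult_P InrI)
qed

lemma P_induct [consumes 1, case_names one inl inr]:
  assumes X: "X \<in> carrier P"
    and one: "Q \<one>\<^bsub>P\<^esub>"
    and inl: "\<And>a Y. a \<in> carrier G \<Longrightarrow> Y \<in> carrier P \<Longrightarrow> Q Y
      \<Longrightarrow> Q (free_product_inl G H a \<otimes>\<^bsub>P\<^esub> Y)"
    and inr: "\<And>b Y. b \<in> carrier H \<Longrightarrow> Y \<in> carrier P \<Longrightarrow> Q Y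
      \<Longrightarrow> Q (free_product_inr G H b \<otimes>\<^bsub>P\<^esub> Y)"
  shows "Q X"
proof -
  have "Q (R `` {u})" if "u \<in> W" for u
    using that
  proof (induction u)
    case Nil
    then show ?case using one by (simp add: one_P)
  next
    case (Cons s u)
    then have u: "u \<in> W" and s: "s \<in> carrier G <+> carrier H" and Q: "Q (R `` {u})" by auto
    have *: "R `` {s # u} = R `` {[s]} \<otimes>\<^bsub>P\<^esub> R `` {u}"
      using mult_P[of "[s]" u] s u by simp
    show ?case
    proof (cases s)
      case (Inl a)
      then show ?thesis
        using inl[OF _ class_in_carrier[OF u] Q] * s by (auto simp: free_product_inl_def)
    next
      case (Inr b)
      then show ?thesis
        using inr[OF _ class_in_carrier[OF u] Q] * s by (auto simp: free_product_inr_def)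
    qed
  qed
  then show ?thesis using X by (metis carrierE)
qed

end

locale free_product_homs = two_groups G H + K: group K
  for G :: "('a, 'm) monoid_scheme" and H :: "('b, 'n) monoid_scheme"
    and K :: "('c, 'k) monoid_scheme" +
  fixes f h
  assumes f: "f \<in> hom G K" and h: "h \<in> hom H K"
begin

lemma letter_value: "s \<in> carrier G <+> carrier H \<Longrightarrow> case_sum f h s \<in> carrier K"
  using hom_in_carrier[OF f] hom_in_carrier[OF h] by auto

lemma word_value_closed: "u \<in> W \<Longrightarrow> word_value K f h u \<in> carrier K"
  by (induction u) (auto simp: word_value_def simp del: Plus_def dest!: letter_value)

lemma word_value_append:
  "u \<in> W \<Longrightarrow> v \<in> W
    \<Longrightarrow> word_value K f h (u @ v) = word_value K f h u \<otimes>\<^bsub>K\<^esub> word_value K f h v"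
proof (induction u)
  case Nil
  then show ?case using word_value_closed by (simp add: word_value_def)
next
  case (Cons s u)
  then show ?case
    using letter_value[of s] word_value_closed[of u] word_value_closed[of v]
    by (simp add: word_value_def K.m_assoc)
qed

lemma word_value_context:
  assumes "p \<in> W" "q \<in> W" "u \<in> W" "v \<in> W" "word_value K f h u = word_value K f h v"
  shows "word_value K f h (p @ u @ q) = word_value K f h (p @ v @ q)"
proof -
  have "u @ q \<in> W" "v @ q \<in> W" using assms by simp_all
  then show ?thesis using assms by (simp only: word_value_append)
qed

lemma word_value_respects: "(u, v) \<in> R \<Longrightarrow> word_value K f h u = word_value K f h v"
proof (induction rule: free_product_rel.induct)
  case (refl u)
  show ?case by (rule HOL.refl)
next
  case (sym u v)
  show ?case by (rule HOL.sym[OF sym.IH])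
next
  case (trans u v w)
  show ?case by (rule HOL.trans[OF trans.IH])
next
  case (one_left u v)
  then show ?case
    using word_value_context[of u v "[Inl \<one>\<^bsub>G\<^esub>]" "[]"] hom_one[OF f grp_left K.is_group]
    by (simp add: word_value_def InlI)
next
  case (one_right u v)
  then show ?case
    using word_value_context[of u v "[Inr \<one>\<^bsub>H\<^esub>]" "[]"] hom_one[OF h grp_right K.is_group]
    by (simp add: word_value_def InrI)
next
  case (mult_left u v a b)
  have "word_value K f h [Inl a, Inl b] = word_value K f h [Inl (a \<otimes>\<^bsub>G\<^esub> b)]"
    using hom_mult[OF f] hom_in_carrier[OF f] mult_left by (simp add: word_value_def)
  moreover have "[Inl a, Inl b] \<in> W" "[Inl (a \<otimes>\<^bsub>G\<^esub> b)] \<in> W"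
    using mult_left by auto
  ultimately show ?case
    using mult_left by (intro word_value_context)
next
  case (mult_right u v a b)
  have "word_value K f h [Inr a, Inr b] = word_value K f h [Inr (a \<otimes>\<^bsub>H\<^esub> b)]"
    using hom_mult[OF h] hom_in_carrier[OF h] mult_right by (simp add: word_value_def)
  moreover have "[Inr a, Inr b] \<in> W" "[Inr (a \<otimes>\<^bsub>H\<^esub> b)] \<in> W"
    using mult_right by auto
  ultimately show ?case
    using mult_right by (intro word_value_context)
qed

lemma lift_class:
  assumes "u \<in> W"
  shows "free_product_lift K f h (R `` {u}) = word_value K f h u"
proof -
  have "word_value K f h ` (R `` {u}) = {word_value K f h u}"
  proof (intro equalityI subsetI)
    fix y assume "y \<in> word_value K f h ` (R `` {u})"
    then obtain v where v: "(u, v) \<in> R" "y = word_value K f h v" by blast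
    show "y \<in> {word_value K f h u}" using word_value_respects[OF v(1)] v(2) by simp
  next
    fix y assume "y \<in> {word_value K f h u}"
    then show "y \<in> word_value K f h ` (R `` {u})"
      using free_product_rel.refl[OF assms] by blast
  qed
  then show ?thesis by (simp add: free_product_lift_def)
qed

lemma lift_hom: "free_product_lift K f h \<in> hom P K"
proof (rule homI)
  fix X Y assume "X \<in> carrier P" "Y \<in> carrier P"
  then obtain u v where "u \<in> W" "X = R `` {u}" "v \<in> W" "Y = R `` {v}"
    by (metis carrierE)
  then show "free_product_lift K f h X \<in> carrier K"
    "free_product_lift K f h (X \<otimes>\<^bsub>P\<^esub> Y) = free_product_lift K f h X \<otimes>\<^bsub>K\<^esub> free_product_lift K f h Y"
    by (auto simp: mult_P lift_class word_value_append word_value_closed)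
qed

lemma lift_inl: "a \<in> carrier G \<Longrightarrow> free_product_lift K f h (free_product_inl G H a) = f a"
  using hom_in_carrier[OF f]
  by (simp add: free_product_inl_def lift_class InlI) (simp add: word_value_def)

lemma lift_inr: "b \<in> carrier H \<Longrightarrow> free_product_lift K f h (free_product_inr G H b) = h b"
  using hom_in_carrier[OF h]
  by (simp add: free_product_inr_def lift_class InrI) (simp add: word_value_def)

lemma lift_unique:
  assumes k: "k \<in> hom P K"
    and kl: "\<And>a. a \<in> carrier G \<Longrightarrow> k (free_product_inl G H a) = f a"
    and kr: "\<And>b. b \<in> carrier H \<Longrightarrow> k (free_product_inr G H b) = h b"
    and X: "X \<in> carrier P"
  shows "k X = free_product_lift K f h X"
  using X
proof (induction rule: P_induct)
  case one
  then show ?case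
    using hom_one[OF k group_P K.is_group] hom_one[OF lift_hom group_P K.is_group] by simp
next
  case (inl a Y)
  then show ?case
    using hom_mult[OF k] hom_mult[OF lift_hom] hom_in_carrier[OF inl_hom] kl lift_inl by simp
next
  case (inr b Y)
  then show ?case
    using hom_mult[OF k] hom_mult[OF lift_hom] hom_in_carrier[OF inr_hom] kr lift_inr by simp
qed

end


section \<open>Substitution and the generating set of the free product\<close>

lemma (in group) subst_x_hom:
  assumes "g \<in> carrier G"
  shows "(\<lambda>w. subst_x G w g) \<in> hom (adjoin_x G) G"
    and "\<And>a. a \<in> carrier G \<Longrightarrow> subst_x G (free_product_inl G integer_group a) g = a"
    and "subst_x G (indet G) g = g"
proof -
  interpret free_product_homs G integer_group G "\<lambda>a. a" "\<lambda>n::int. g [^] n"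
    by (intro free_product_homs.intro two_groups.intro free_product_homs_axioms.intro is_group
          group_integer_group)
      (auto simp: hom_def int_pow_mult assms)
  show "(\<lambda>w. subst_x G w g) \<in> hom (adjoin_x G) G"
    using lift_hom by (simp add: subst_x_def[abs_def])
  show "\<And>a. a \<in> carrier G \<Longrightarrow> subst_x G (free_product_inl G integer_group a) g = a"
    using lift_inl by (simp add: subst_x_def)
  show "subst_x G (indet G) g = g"
    using lift_inr[of 1] assms by (simp add: subst_x_def indet_def int_pow_1)
qed

lemma (in group) ex_word:
  assumes "S \<subseteq> carrier G" "g \<in> generate G S"
  shows "\<exists>u. set u \<subseteq> S \<union> (\<lambda>s. inv s) ` S \<and> foldr (\<lambda>s y. s \<otimes> y) u \<one> = g"
  using assms(2)
proof induction
  case one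
  show ?case by (intro exI[of _ "[]"]) simp
next
  case (incl s)
  then show ?case using assms(1) by (intro exI[of _ "[s]"]) auto
next
  case (inv s)
  then show ?case using assms(1) by (intro exI[of _ "[inv s]"]) auto
next
  case (eng a b)
  then obtain u v where u: "set u \<subseteq> S \<union> (\<lambda>s. inv s) ` S" "foldr (\<lambda>s y. s \<otimes> y) u \<one> = a"
    and v: "set v \<subseteq> S \<union> (\<lambda>s. inv s) ` S" "foldr (\<lambda>s y. s \<otimes> y) v \<one> = b" by blast
  have b: "b \<in> carrier G" using generate_in_carrier[OF assms(1) eng(2)] .
  have "foldr (\<lambda>s y. s \<otimes> y) w \<one> \<in> carrier G \<and>
      foldr (\<lambda>s y. s \<otimes> y) w b = foldr (\<lambda>s y. s \<otimes> y) w \<one> \<otimes> b"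
    if "set w \<subseteq> carrier G" for w
    using that b by (induction w) (auto simp: m_assoc)
  moreover have "set u \<subseteq> carrier G" using u(1) assms(1) by auto
  ultimately have "foldr (\<lambda>s y. s \<otimes> y) u b = a \<otimes> b" using u(2) by blast
  then show ?case using u v by (intro exI[of _ "u @ v"]) simp
qed

lemma (in group) word_length_word:
  assumes "S \<subseteq> carrier G" "g \<in> generate G S"
  shows "\<exists>u. length u = word_length G S g \<and> set u \<subseteq> S \<union> (\<lambda>s. inv s) ` S \<and>
    foldr (\<lambda>s y. s \<otimes> y) u \<one> = g"
  unfolding word_length_def
  by (rule LeastI_ex) (use ex_word[OF assms] in blast)

lemma (in group) finite_word_length_le:
  assumes "S \<subseteq> carrier G" "finite S" "generate G S = carrier G"
  shows "finite {g \<in> carrier G. word_length G S g \<le> l}"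
proof (rule finite_subset)
  let ?A = "{u. set u \<subseteq> S \<union> (\<lambda>s. inv s) ` S \<and> length u \<le> l}"
  show "{g \<in> carrier G. word_length G S g \<le> l} \<subseteq> (\<lambda>u. foldr (\<lambda>s y. s \<otimes> y) u \<one>) ` ?A"
    using word_length_word[OF assms(1)] assms(3) by fastforce
  show "finite ((\<lambda>u. foldr (\<lambda>s y. s \<otimes> y) u \<one>) ` ?A)"
    using assms(2) by (intro finite_imageI finite_lists_length_le) auto
qed

lemma (in group) generate_MIF_gens:
  assumes "S \<subseteq> carrier G" "generate G S = carrier G"
  shows "MIF_gens G S \<subseteq> carrier (adjoin_x G)"
    and "generate (adjoin_x G) (MIF_gens G S) = carrier (adjoin_x G)"
proof -
  interpret two_groups G integer_group
    by (intro two_groups.intro is_group group_integer_group)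
  interpret P: group P by (rule group_P)
  interpret inl: group_hom G P "free_product_inl G integer_group"
    by (intro group_hom.intro group_hom_axioms.intro inl_hom is_group group_P)
  interpret inr: group_hom integer_group P "free_product_inr G integer_group"
    by (intro group_hom.intro group_hom_axioms.intro inr_hom group_integer_group group_P)
  let ?T = "MIF_gens G S"
  show sub: "?T \<subseteq> carrier P"
    using assms(1) inl.hom_closed inr.hom_closed[of 1] by (auto simp: MIF_gens_def indet_def)
  interpret T: subgroup "generate P ?T" P
    by (rule P.generate_is_subgroup[OF sub])
  have "w \<in> generate P ?T" if "w \<in> carrier P" for w
    using that
  proof (induction rule: P_induct)
    case one
    show ?case by (rule T.one_closed)
  next
    case (inl a Y)
    have "free_product_inl G integer_group a \<in> generate P (free_product_inl G integer_group ` S)"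
      using inl.generate_img[OF assms(1)] assms(2) inl(1) by auto
    then have "free_product_inl G integer_group a \<in> generate P ?T"
      using P.mono_generate[of "free_product_inl G integer_group ` S" ?T]
      by (auto simp: MIF_gens_def)
    then show ?case using inl by (blast intro: T.m_closed)
  next
    case (inr n Y)
    have "indet G [^]\<^bsub>P\<^esub> n \<in> generate P ?T"
      by (rule P.subgroup_int_pow_closed[OF T.subgroup_axioms])
        (auto simp: MIF_gens_def intro: generate.incl)
    moreover have "free_product_inr G integer_group n = indet G [^]\<^bsub>P\<^esub> n"
      using inr.hom_int_pow[of 1 n] by (simp add: indet_def)
    ultimately show ?case using inr by (auto intro: T.m_closed)
  qed
  then show "generate P ?T = carrier P"
    using T.subset by blast
qed

lemma (in group) indet_nontrivial: "indet G \<noteq> \<one>\<^bsub>adjoin_x G\<^esub>"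
proof -
  interpret free_product_homs G integer_group integer_group "\<lambda>_. 0" "\<lambda>n. n"
    by (intro free_product_homs.intro two_groups.intro free_product_homs_axioms.intro is_group
          group_integer_group)
      (auto simp: hom_def)
  show ?thesis
    using lift_inr[of 1] hom_one[OF lift_hom group_P group_integer_group]
    by (auto simp: indet_def)
qed

lemma (in group) MIF_ball:
  assumes "S \<subseteq> carrier G" "finite S" "generate G S = carrier G"
  defines "B \<equiv> (\<lambda>l. {w \<in> carrier (adjoin_x G). w \<noteq> \<one>\<^bsub>adjoin_x G\<^esub> \<and>
    word_length (adjoin_x G) (MIF_gens G S) w \<le> l})"
  shows "finite (B l)" and "l \<ge> 1 \<Longrightarrow> indet G \<in> B l"
proof -
  interpret two_groups G integer_group
    by (intro two_groups.intro is_group group_integer_group)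
  interpret P: group P by (rule group_P)
  note gens = generate_MIF_gens[OF assms(1,3)]
  have "finite (MIF_gens G S)" using assms(2) by (simp add: MIF_gens_def)
  then show "finite (B l)"
    using P.finite_word_length_le[OF gens(1) _ gens(2), of l] unfolding B_def
    by (auto elim: rev_finite_subset)
  have x: "indet G \<in> carrier P" using gens(1) by (simp add: MIF_gens_def)
  have "word_length P (MIF_gens G S) (indet G) \<le> 1"
    unfolding word_length_def
    by (rule Least_le) (use x in \<open>auto simp: MIF_gens_def intro!: exI[of _ "[indet G]"]\<close>)
  then show "l \<ge> 1 \<Longrightarrow> indet G \<in> B l"
    using x indet_nontrivial by (simp add: B_def)
qed

end

theory Submission
  imports Defs
begin

text \<open>
  There are at most \<open>K\<^sup>n\<close> elements of length at most \<open>n\<close>. For each of them, \<open>g\<close> say, the commutator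
  \<open>[x, g]\<close> is a word of length \<open>O(n)\<close> vanishing at \<open>g\<close>, and a commutator of two words vanishes
  wherever one of them does. A balanced binary tree of commutators therefore yields a word that
  vanishes on the whole ball and has length exponential in \<open>n\<close>; conjugating the leaves and the
  inner nodes suitably makes it reduced as written, hence nontrivial in the free product.
\<close>

section \<open>Word length\<close>

text \<open>The length estimates below are used for two marked groups: \<open>G\<close> with
  \<open>S\<close>, and the free product \<open>P\<close> with \<open>MIF_gens G S\<close>,
  interpreted as \<open>ext\<close> in \<open>word_length_class_le_cost\<close>.\<close>

locale marked_group = group G for G (structure) +
  fixes S
  assumes gens_closed: "S \<subseteq> carrier G" and generate_gens: "generate G S = carrier G"
begin

abbreviation eval_word :: "'a list \<Rightarrow> 'a" where
  "eval_word u \<equiv> foldr (\<lambda>s y. s \<otimes> y) u \<one>"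

abbreviation gen_letters :: "'a set" where
  "gen_letters \<equiv> S \<union> (\<lambda>s. inv s) ` S"

abbreviation len :: "'a \<Rightarrow> nat" where
  "len \<equiv> word_length G S"

lemma gen_letters_closed: "gen_letters \<subseteq> carrier G"
  using gens_closed by auto

lemma eval_word_closed: "set u \<subseteq> carrier G \<Longrightarrow> eval_word u \<in> carrier G"
  by (induction u) auto

lemma eval_word_append:
  "set u \<subseteq> carrier G \<Longrightarrow> set v \<subseteq> carrier G \<Longrightarrow> eval_word (u @ v) = eval_word u \<otimes> eval_word v"
  by (induction u) (auto simp: m_assoc eval_word_closed)

lemma eval_word_inverse:
  "set u \<subseteq> carrier G \<Longrightarrow> eval_word (rev (map (\<lambda>s. inv s) u)) = inv (eval_word u)"
proof (induction u)
  case (Cons s u)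
  have *: "set (rev (map (\<lambda>s. inv s) u)) \<subseteq> carrier G" using Cons.prems by auto
  have "eval_word (rev (map (\<lambda>s. inv s) (s # u)))
      = eval_word (rev (map (\<lambda>s. inv s) u)) \<otimes> eval_word [inv s]"
    using eval_word_append[OF *, of "[inv s]"] Cons.prems by simp
  then show ?case using Cons by (simp add: inv_mult_group eval_word_closed)
qed simp

lemma len_word:
  assumes "g \<in> carrier G"
  obtains u where "length u = len g" "set u \<subseteq> gen_letters" "eval_word u = g"
  using word_length_word[OF gens_closed] assms generate_gens by blast

lemma len_le: "set u \<subseteq> gen_letters \<Longrightarrow> len (eval_word u) \<le> length u"
  unfolding word_length_def by (rule Least_le) blast

lemma len_one: "len \<one> = 0"
  using len_le[of "[]"] by simp

lemma len_eq_0: "g \<in> carrier G \<Longrightarrow> len g = 0 \<Longrightarrow> g = \<one>"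
  by (erule len_word) auto

lemma len_gen: "s \<in> S \<Longrightarrow> len s \<le> 1"
  using len_le[of "[s]"] gens_closed by auto

lemma len_mult:
  assumes "g \<in> carrier G" "h \<in> carrier G"
  shows "len (g \<otimes> h) \<le> len g + len h"
proof -
  obtain u v where u: "length u = len g" "set u \<subseteq> gen_letters" "eval_word u = g"
    and v: "length v = len h" "set v \<subseteq> gen_letters" "eval_word v = h"
    using len_word assms by metis
  then show ?thesis
    using len_le[of "u @ v"] eval_word_append[of u v] subset_trans[OF _ gen_letters_closed]
    by (simp del: foldr_append)
qed

lemma len_inv_le:
  assumes "g \<in> carrier G"
  shows "len (inv g) \<le> len g"
proof -
  obtain u where u: "length u = len g" "set u \<subseteq> gen_letters" "eval_word u = g"
    using len_word assms by metis
  have "set (rev (map (\<lambda>s. inv s) u)) \<subseteq> gen_letters"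
    using u(2) gens_closed by (auto simp: subset_iff)
  then show ?thesis
    using len_le[of "rev (map (\<lambda>s. inv s) u)"] eval_word_inverse[of u] u gen_letters_closed by auto
qed

lemma len_inv: "g \<in> carrier G \<Longrightarrow> len (inv g) = len g"
  using len_inv_le[of g] len_inv_le[of "inv g"] by simp

lemma card_ball:
  assumes "finite S"
  shows "finite {g \<in> carrier G. len g \<le> n}"
    and "card {g \<in> carrier G. len g \<le> n} \<le> (card gen_letters + 1) ^ n"
proof -
  let ?A = "{u. set u \<subseteq> gen_letters \<and> length u \<le> n}"
  have A: "finite gen_letters" "finite ?A"
    using assms by (auto intro!: finite_lists_length_le)
  show "finite {g \<in> carrier G. len g \<le> n}"
    by (rule finite_word_length_le[OF gens_closed assms generate_gens])
  have "{g \<in> carrier G. len g \<le> n} \<subseteq> eval_word ` ?A"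
  proof
    fix g assume "g \<in> {g \<in> carrier G. len g \<le> n}"
    moreover from this obtain u
      where "length u = len g" "set u \<subseteq> gen_letters" "eval_word u = g"
      using len_word by (metis (no_types, lifting) mem_Collect_eq)
    ultimately show "g \<in> eval_word ` ?A" by (auto intro!: rev_image_eqI[of u])
  qed
  then have "card {g \<in> carrier G. len g \<le> n} \<le> card ?A"
    by (rule surj_card_le[OF A(2)])
  also have "\<dots> = (\<Sum>i\<le>n. card gen_letters ^ i)"
    by (rule card_lists_length_le[OF A(1)])
  also have "\<dots> \<le> (card gen_letters + 1) ^ n"
    \<comment> \<open>The powers of \<open>card gen_letters\<close> being summed are the terms of
      the binomial expansion with their coefficients, all at least 1, dropped.\<close>
    unfolding binomial_ring[of "card gen_letters" 1 n]
    by (intro sum_mono) (auto simp: Suc_leI)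
  finally show "card {g \<in> carrier G. len g \<le> n} \<le> (card gen_letters + 1) ^ n" .
qed

end


section \<open>Reduced words in a free product\<close>

context two_groups
begin

definition reduced :: "('a + 'b) list \<Rightarrow> bool" where
  "reduced u \<longleftrightarrow> set u \<subseteq> (carrier G - {\<one>\<^bsub>G\<^esub>}) <+> (carrier H - {\<one>\<^bsub>H\<^esub>}) \<and>
    successively (\<lambda>s t. isl s \<noteq> isl t) u"

definition cons_nontrivial :: "'a + 'b \<Rightarrow> ('a + 'b) list \<Rightarrow> ('a + 'b) list" where
  "cons_nontrivial s v = (if s = Inl \<one>\<^bsub>G\<^esub> \<or> s = Inr \<one>\<^bsub>H\<^esub> then v else s # v)"

text \<open>Left multiplication by a single letter, carried out on normal forms. Once a head letter
  has been erased, the next letter belongs to the other factor, so no further cancellation has to be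
  propagated.\<close>

fun push :: "'a + 'b \<Rightarrow> ('a + 'b) list \<Rightarrow> ('a + 'b) list" where
  "push (Inl a) (Inl b # v) = cons_nontrivial (Inl (a \<otimes>\<^bsub>G\<^esub> b)) v"
| "push (Inr a) (Inr b # v) = cons_nontrivial (Inr (a \<otimes>\<^bsub>H\<^esub> b)) v"
| "push s v = cons_nontrivial s v"

lemma reduced_words: "reduced u \<Longrightarrow> u \<in> W"
  by (auto simp: reduced_def)

lemma reduced_Nil: "reduced []"
  by (simp add: reduced_def)

lemma reduced_Cons_iff:
  "reduced (s # u) \<longleftrightarrow> s \<in> (carrier G - {\<one>\<^bsub>G\<^esub>}) <+> (carrier H - {\<one>\<^bsub>H\<^esub>}) \<and> reduced u \<and>
     (u = [] \<or> isl s \<noteq> isl (hd u))"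
  by (auto simp: reduced_def successively_Cons)

lemma reduced_append_iff:
  "reduced (u @ v) \<longleftrightarrow>
     reduced u \<and> reduced v \<and> (u = [] \<or> v = [] \<or> isl (last u) \<noteq> isl (hd v))"
  by (auto simp: reduced_def successively_append_iff)

lemma reduced_push: "s \<in> carrier G <+> carrier H \<Longrightarrow> reduced w \<Longrightarrow> reduced (push s w)"
  by (cases "(s, w)" rule: push.cases) (auto simp: cons_nontrivial_def reduced_Cons_iff)

lemma reduced_foldr_push: "u \<in> W \<Longrightarrow> reduced w \<Longrightarrow> reduced (foldr push u w)"
  by (induction u) (auto intro!: reduced_push)

lemma push_one:
  assumes "reduced w"
  shows "push (Inl \<one>\<^bsub>G\<^esub>) w = w" and "push (Inr \<one>\<^bsub>H\<^esub>) w = w"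
  using assms
  by (cases w rule: list.exhaust; cases "hd w"; auto simp: cons_nontrivial_def reduced_Cons_iff)+

lemma push_Inl_mult:
  assumes "reduced w" "a \<in> carrier G" "b \<in> carrier G"
  shows "push (Inl a) (push (Inl b) w) = push (Inl (a \<otimes>\<^bsub>G\<^esub> b)) w"
proof (cases w)
  case Nil
  then show ?thesis using assms by (auto simp: cons_nontrivial_def)
next
  case (Cons s v)
  show ?thesis
  proof (cases s)
    case (Inl c)
    \<comment> \<open>The delicate case is \<open>b\<close> cancelling \<open>c\<close>: then
      \<open>v\<close> is empty or starts in \<open>H\<close>, so pushing \<open>a\<close> merely
      prepends it, and \<open>a\<close> is also the product of \<open>a\<close>, \<open>b\<close>
      and \<open>c\<close>.\<close>
    then have c: "c \<in> carrier G" and v: "v = [] \<or> (\<exists>t v'. v = Inr t # v')"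
      using assms(1) Cons by (auto simp: reduced_Cons_iff neq_Nil_conv isl_def)
    have "a \<otimes>\<^bsub>G\<^esub> b \<otimes>\<^bsub>G\<^esub> c = a \<otimes>\<^bsub>G\<^esub> (b \<otimes>\<^bsub>G\<^esub> c)"
      using assms c by (simp add: left.m_assoc)
    then show ?thesis using v assms c Inl Cons by (auto simp: cons_nontrivial_def)
  next
    case (Inr c)
    then show ?thesis using assms Cons by (auto simp: cons_nontrivial_def)
  qed
qed

lemma push_Inr_mult:
  assumes "reduced w" "a \<in> carrier H" "b \<in> carrier H"
  shows "push (Inr a) (push (Inr b) w) = push (Inr (a \<otimes>\<^bsub>H\<^esub> b)) w"
proof (cases w)
  case Nil
  then show ?thesis using assms by (auto simp: cons_nontrivial_def)
next
  case (Cons s v)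
  show ?thesis
  proof (cases s)
    case (Inr c)
    then have c: "c \<in> carrier H" and v: "v = [] \<or> (\<exists>t v'. v = Inl t # v')"
      using assms(1) Cons by (auto simp: reduced_Cons_iff neq_Nil_conv isl_def)
    have "a \<otimes>\<^bsub>H\<^esub> b \<otimes>\<^bsub>H\<^esub> c = a \<otimes>\<^bsub>H\<^esub> (b \<otimes>\<^bsub>H\<^esub> c)"
      using assms c by (simp add: right.m_assoc)
    then show ?thesis using v assms c Inr Cons by (auto simp: cons_nontrivial_def)
  next
    case (Inl c)
    then show ?thesis using assms Cons by (auto simp: cons_nontrivial_def)
  qed
qed

text \<open>Van der Waerden's argument: the free product acts on the set of reduced words.\<close>

lemma foldr_push_respects:
  "(u, v) \<in> R \<Longrightarrow> reduced w \<Longrightarrow> foldr push u w = foldr push v w"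
proof (induction arbitrary: w rule: free_product_rel.induct)
  case (one_left u v)
  then show ?case using reduced_foldr_push push_one(1) by simp
next
  case (one_right u v)
  then show ?case using reduced_foldr_push push_one(2) by simp
next
  case (mult_left u v a b)
  then show ?case using reduced_foldr_push push_Inl_mult by simp
next
  case (mult_right u v a b)
  then show ?case using reduced_foldr_push push_Inr_mult by simp
qed simp_all

text \<open>Acting on the empty word gives a reduced word back unchanged, because none of its
  letters meets a head from its own factor. Hence the action tells reduced words apart.\<close>

lemma foldr_push_reduced: "reduced u \<Longrightarrow> foldr push u [] = u"
proof (induction u)
  case (Cons s u)
  then have "foldr push u [] = u" by (simp add: reduced_Cons_iff)
  with Cons.prems show ?case
    by (cases "(s, u)" rule: push.cases) (auto simp: cons_nontrivial_def reduced_Cons_iff)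
qed simp

text \<open>The class of \<open>u\<close> sends the empty word to \<open>u\<close>, while the
  identity fixes the empty word.\<close>

lemma reduced_nontrivial:
  assumes "reduced u" "u \<noteq> []"
  shows "R `` {u} \<noteq> \<one>\<^bsub>P\<^esub>"
proof
  assume "R `` {u} = \<one>\<^bsub>P\<^esub>"
  then have "(u, []) \<in> R"
    using class_eq_iff[OF reduced_words[OF assms(1)], of "[]"] by (simp add: one_P)
  then have "foldr push u [] = []"
    using foldr_push_respects[of u "[]" "[]"] reduced_Nil by simp
  then show False using foldr_push_reduced assms by simp
qed

text \<open>Inverses are taken on words rather than on classes, so that reducedness, the end letters
  and the cost remain under control.\<close>

definition word_inv :: "('a + 'b) list \<Rightarrow> ('a + 'b) list" where
  "word_inv u = rev (map (map_sum (\<lambda>a. inv\<^bsub>G\<^esub> a) (\<lambda>b. inv\<^bsub>H\<^esub> b)) u)"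

lemma word_inv_words: "u \<in> W \<Longrightarrow> word_inv u \<in> W"
  by (fastforce simp: word_inv_def)

lemma word_inv_eq_Nil_iff [simp]: "word_inv u = [] \<longleftrightarrow> u = []"
  by (simp add: word_inv_def)

lemma isl_hd_word_inv: "u \<noteq> [] \<Longrightarrow> isl (hd (word_inv u)) = isl (last u)"
  by (simp add: word_inv_def hd_rev last_map isl_map_sum)

lemma isl_last_word_inv: "u \<noteq> [] \<Longrightarrow> isl (last (word_inv u)) = isl (hd u)"
  by (simp add: word_inv_def last_rev hd_map isl_map_sum)

lemma reduced_word_inv:
  assumes "reduced u"
  shows "reduced (word_inv u)"
proof -
  \<comment> \<open>Alternation of factors is a symmetric relation, so it survives reversal, and
    inverting a letter does not change its factor.\<close>
  have "successively (\<lambda>s t. isl s \<noteq> isl t) (word_inv u)"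
    using assms
    by (auto simp: reduced_def word_inv_def successively_map isl_map_sum elim: successively_mono)
  then show ?thesis
    using assms by (fastforce simp: reduced_def word_inv_def)
qed

end

context free_product_homs
begin

lemma word_value_word_inv:
  "u \<in> W \<Longrightarrow> word_value K f h (word_inv u) = inv\<^bsub>K\<^esub> word_value K f h u"
proof (induction u)
  case Nil
  then show ?case by (simp add: word_inv_def word_value_def)
next
  case (Cons s u)
  interpret f: group_hom G K f
    by (intro group_hom.intro group_hom_axioms.intro f grp_left K.is_group)
  interpret h: group_hom H K h
    by (intro group_hom.intro group_hom_axioms.intro h grp_right K.is_group)
  let ?t = "map_sum (\<lambda>a. inv\<^bsub>G\<^esub> a) (\<lambda>b. inv\<^bsub>H\<^esub> b) s"
  have s: "s \<in> carrier G <+> carrier H" and u: "u \<in> W" using Cons.prems by auto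
  then have t: "[?t] \<in> W" by auto
  have "word_value K f h [?t] = inv\<^bsub>K\<^esub> (case_sum f h s)"
    using s by (auto simp: word_value_def)
  moreover have "word_inv (s # u) = word_inv u @ [?t]" by (simp add: word_inv_def)
  ultimately have "word_value K f h (word_inv (s # u))
      = inv\<^bsub>K\<^esub> word_value K f h u \<otimes>\<^bsub>K\<^esub> inv\<^bsub>K\<^esub> (case_sum f h s)"
    using word_value_append[OF word_inv_words[OF u] t] Cons.IH[OF u] by simp
  also have "\<dots> = inv\<^bsub>K\<^esub> (case_sum f h s \<otimes>\<^bsub>K\<^esub> word_value K f h u)"
    using letter_value[OF s] word_value_closed[OF u] by (simp add: K.inv_mult_group)
  finally show ?case by (simp add: word_value_def)
qed

end


section \<open>Short words vanishing on balls\<close>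

sublocale marked_group \<subseteq> two_groups G integer_group
  by (intro two_groups.intro is_group group_integer_group)

context marked_group
begin

text \<open>An additive upper bound for the word length in the free product: each letter is spelled
  out separately, \<open>Inr n\<close> standing for the \<open>n\<close>-th power of x.\<close>

definition cost :: "('a + int) list \<Rightarrow> nat" where
  "cost u = sum_list (map (case_sum len (\<lambda>n. nat \<bar>n\<bar>)) u)"

lemma cost_simps [simp]:
  "cost [] = 0"
  "cost (Inl a # u) = len a + cost u"
  "cost (Inr n # u) = nat \<bar>n\<bar> + cost u"
  "cost (u @ v) = cost u + cost v"
  by (simp_all add: cost_def)

lemma cost_word_inv: "u \<in> W \<Longrightarrow> cost (word_inv u) = cost u"
proof (induction u)
  case (Cons s u)
  then show ?case by (cases s) (auto simp: word_inv_def len_inv)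
qed (simp add: word_inv_def)

text \<open>A shortest word over \<open>S\<close> for a letter \<open>a\<close> maps generator by
  generator to a word for its image, and a power of x is a product of copies of x or of their
  inverses. Subadditivity of length then handles the whole word.\<close>

lemma word_length_class_le_cost:
  assumes "u \<in> W"
  shows "word_length P (MIF_gens G S) (R `` {u}) \<le> cost u"
proof -
  interpret ext: marked_group P "MIF_gens G S"
    using group_P generate_MIF_gens[OF gens_closed generate_gens]
    by (intro marked_group.intro marked_group_axioms.intro)
  interpret inl: group_hom G P "free_product_inl G integer_group"
    by (intro group_hom.intro group_hom_axioms.intro inl_hom is_group group_P)
  interpret inr: group_hom integer_group P "free_product_inr G integer_group"
    by (intro group_hom.intro group_hom_axioms.intro inr_hom group_integer_group group_P)
  have inl_le: "ext.len (free_product_inl G integer_group a) \<le> len a" if a: "a \<in> carrier G" for a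
  proof -
    have gen: "ext.len (free_product_inl G integer_group s) \<le> 1" if "s \<in> gen_letters" for s
    proof -
      have "ext.len (free_product_inl G integer_group s) \<le> 1" if "s \<in> S" for s
        using that by (intro ext.len_gen) (simp add: MIF_gens_def)
      then show ?thesis
        using that gens_closed by (auto simp: inl.hom_inv ext.len_inv subset_iff)
    qed
    have "ext.len (free_product_inl G integer_group (eval_word v)) \<le> length v"
      if "set v \<subseteq> gen_letters" for v
      using that
    proof (induction v)
      case Nil
      then show ?case by (simp add: ext.len_one)
    next
      case (Cons s v)
      have "set v \<subseteq> carrier G" "s \<in> carrier G"
        using Cons.prems gen_letters_closed by auto
      then show ?case
        using gen[of s] Cons ext.len_mult[of "free_product_inl G integer_group s"
            "free_product_inl G integer_group (eval_word v)"] eval_word_closed[of v]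
        by simp
    qed
    then show ?thesis using len_word[OF a] by metis
  qed
  have inr_nat: "ext.len (free_product_inr G integer_group (int k)) \<le> k" for k
  proof (induction k)
    case 0
    then show ?case using inr.hom_one by (simp add: ext.len_one)
  next
    case (Suc k)
    have "ext.len (free_product_inr G integer_group 1) \<le> 1"
      by (intro ext.len_gen) (simp add: MIF_gens_def indet_def)
    then show ?case
      using Suc inr.hom_mult[of 1 "int k"] inr.hom_closed[of 1] inr.hom_closed[of "int k"]
        ext.len_mult[of "free_product_inr G integer_group 1"
          "free_product_inr G integer_group (int k)"]
      by simp
  qed
  have inr_le: "ext.len (free_product_inr G integer_group n) \<le> nat \<bar>n\<bar>" for n :: int
  proof (cases "n \<ge> 0")
    case True
    then show ?thesis using inr_nat[of "nat n"] by simp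
  next
    case False
    then have "free_product_inr G integer_group n
        = inv\<^bsub>P\<^esub> free_product_inr G integer_group (int (nat (- n)))"
      using inr.hom_inv[of "- n"] by simp
    then show ?thesis
      using False inr_nat[of "nat (- n)"] inr.hom_closed by (simp add: ext.len_inv)
  qed
  show ?thesis
    using assms
  proof (induction u)
    case Nil
    then show ?case using ext.len_one by (simp add: one_P)
  next
    case (Cons s u)
    then have s: "s \<in> carrier G <+> carrier integer_group" and u: "u \<in> W" by auto
    have "ext.len (R `` {s # u}) \<le> ext.len (R `` {[s]}) + ext.len (R `` {u})"
      using mult_P[of "[s]" u] ext.len_mult[of "R `` {[s]}" "R `` {u}"] class_in_carrier s u
      by simp
    moreover have "ext.len (R `` {[s]}) \<le> cost [s]"
      using s inl_le inr_le
      by (cases s) (auto simp: free_product_inl_def free_product_inr_def)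
    moreover have "cost (s # u) = cost [s] + cost u"
      by (simp add: cost_def)
    ultimately show ?case using Cons.IH by simp
  qed
qed

text \<open>Substitution of \<open>g\<close> for x on words, which simplification can compute
  without passing to classes; \<open>subst_x_class\<close> links it to
  \<open>subst_x\<close>.\<close>

definition val :: "'a \<Rightarrow> ('a + int) list \<Rightarrow> 'a" where
  "val g u = word_value G (\<lambda>a. a) (\<lambda>n::int. g [^] n) u"

lemma val_homs:
  assumes "g \<in> carrier G"
  shows "free_product_homs G integer_group G (\<lambda>a. a) (\<lambda>n::int. g [^] n)"
  by (intro free_product_homs.intro two_groups.intro free_product_homs_axioms.intro is_group
        group_integer_group)
    (auto simp: hom_def int_pow_mult assms)

lemma val_simps [simp]:
  "val g [] = \<one>"
  "val g (Inl a # u) = a \<otimes> val g u"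
  "val g (Inr n # u) = g [^] n \<otimes> val g u"
  by (simp_all add: val_def word_value_def)

lemma subst_x_class: "g \<in> carrier G \<Longrightarrow> u \<in> W \<Longrightarrow> subst_x G (R `` {u}) g = val g u"
  using free_product_homs.lift_class[OF val_homs] by (simp add: subst_x_def val_def)

lemma val_closed: "g \<in> carrier G \<Longrightarrow> u \<in> W \<Longrightarrow> val g u \<in> carrier G"
  using free_product_homs.word_value_closed[OF val_homs] by (simp add: val_def)

lemma val_append:
  "g \<in> carrier G \<Longrightarrow> u \<in> W \<Longrightarrow> v \<in> W \<Longrightarrow> val g (u @ v) = val g u \<otimes> val g v"
  using free_product_homs.word_value_append[OF val_homs] by (simp add: val_def)

lemma val_word_inv: "g \<in> carrier G \<Longrightarrow> u \<in> W \<Longrightarrow> val g (word_inv u) = inv (val g u)"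
  using free_product_homs.word_value_word_inv[OF val_homs] by (simp add: val_def)

text \<open>
  Words that do not cancel when multiplied by \<open>x\<close> on the left or by a letter of \<open>G\<close> on either
  side.
\<close>

definition x_framed :: "('a + int) list \<Rightarrow> bool" where
  "x_framed u \<longleftrightarrow> reduced u \<and> (\<exists>n v. u = Inr n # v \<and> n > 0) \<and> \<not> isl (last u)"

lemma x_framedD:
  assumes "x_framed u"
  shows "reduced u" "u \<noteq> []" "\<not> isl (hd u)" "\<not> isl (last u)"
  using assms by (auto simp: x_framed_def)

text \<open>\<open>x\<^sup>2 g x\<^sup>-\<^sup>1 g\<^sup>-\<^sup>1 x\<^sup>-\<^sup>1\<close> is a conjugate of the commutator \<open>[x, g]\<close>.\<close>

lemma x_framed_vanishing_at:
  assumes g: "g \<in> carrier G"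
  shows "\<exists>u. x_framed u \<and> cost u \<le> 2 * len g + 4 \<and> val g u = \<one>"
proof (cases "g = \<one>")
  case True
  then show ?thesis
    \<comment> \<open>For \<open>g = \<one>\<close> the commutator word would contain a trivial
      letter; the word x itself already vanishes there.\<close>
    by (intro exI[of _ "[Inr 1]"]) (auto simp: x_framed_def reduced_Cons_iff reduced_Nil)
next
  case False
  let ?u = "[Inr 2, Inl g, Inr (- 1), Inl (inv g), Inr (- 1)] :: ('a + int) list"
  have "x_framed ?u"
    using False g by (auto simp: x_framed_def reduced_Cons_iff reduced_Nil)
  moreover have "cost ?u \<le> 2 * len g + 4" using g by (simp add: len_inv)
  moreover have "val g ?u = \<one>"
  proof -
    have 2: "g [^] (2::int) = g \<otimes> g" using int_pow_mult[OF g, of 1 1] g by simp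
    have 1: "g [^] (-1::int) = inv g" using int_pow_neg[OF g, of 1] g by simp
    have "g \<otimes> (inv g \<otimes> y) = y" if "y \<in> carrier G" for y
      using g that by (simp add: m_assoc[symmetric])
    then show ?thesis using g by (simp add: 1 2 m_assoc)
  qed
  ultimately show ?thesis by blast
qed

text \<open>
  The word represents \<open>x [u, h v h\<^sup>-\<^sup>1] x\<^sup>-\<^sup>1\<close>: conjugating \<open>v\<close> by \<open>h\<close> rules out cancellation inside
  the commutator, and conjugating by \<open>x\<close> restores the frame.
\<close>

lemma x_framed_commutator:
  assumes u: "x_framed u" and v: "x_framed v"
    and h: "h \<in> carrier G" "h \<noteq> \<one>" "len h \<le> 1"
  shows "\<exists>w. x_framed w \<and> cost w \<le> 2 * cost u + 2 * cost v + 6 \<and>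
    (\<forall>g\<in>carrier G. val g u = \<one> \<or> val g v = \<one> \<longrightarrow> val g w = \<one>)"
proof -
  note uD = x_framedD[OF u] and vD = x_framedD[OF v]
  note uW = reduced_words[OF uD(1)] and vW = reduced_words[OF vD(1)]
  obtain n p where n: "u = Inr n # p" "n > 0" using u by (auto simp: x_framed_def)
  define q where "q = Inl h # v @ Inl (inv h) # word_inv u @ Inl h # word_inv v @
    [Inl (inv h), Inr (- 1)]"
  \<comment> \<open>The conjugating x on the left merges with the first letter of \<open>u\<close>.
    Since \<open>n > 0\<close>, the exponent \<open>n + 1\<close> is again positive, so nothing
    cancels; this is why frames start with a positive exponent.\<close>
  define w where "w = Inr (n + 1) # p @ q"
  have W: "word_inv u \<in> W" "word_inv v \<in> W" "p \<in> W"
    using word_inv_words uW vW n by auto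
  have q: "reduced q"
    unfolding q_def
    using h uD vD reduced_word_inv[OF uD(1)] reduced_word_inv[OF vD(1)]
    by (simp add: reduced_Cons_iff reduced_append_iff reduced_Nil isl_hd_word_inv
        isl_last_word_inv InlI InrI)
  then have "reduced (u @ q)"
    using uD by (simp add: reduced_append_iff) (simp add: q_def)
  then have "reduced w" using n by (auto simp: w_def reduced_Cons_iff)
  then have "x_framed w"
    using n(2) by (simp add: x_framed_def w_def q_def)
  \<comment> \<open>The 6 accounts for the four letters \<open>h\<close> or \<open>inv h\<close>,
    each of length at most 1, and for x at either end.\<close>
  moreover have "cost w \<le> 2 * cost u + 2 * cost v + 6"
    using h n uW vW by (simp add: w_def q_def len_inv cost_word_inv)
  moreover have "val g w = \<one>" if g: "g \<in> carrier G" and 1: "val g u = \<one> \<or> val g v = \<one>" for g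
  proof -
    have x: "g [^] (-1::int) = inv g" using int_pow_neg[OF g, of 1] g by simp
    have closed: "val g u \<in> carrier G" "val g v \<in> carrier G" "val g p \<in> carrier G"
      using val_closed g uW vW W by auto
    have pq: "val g (p @ q) = val g p \<otimes> val g q"
      using val_append g W reduced_words[OF q] by blast
    have qW: "[Inl (inv h), Inr (- 1)] \<in> W" using h by (auto simp: InlI InrI)
    have val_q: "val g q = h \<otimes> (val g v \<otimes> (inv h \<otimes> (inv (val g u) \<otimes> (h \<otimes>
        (inv (val g v) \<otimes> (inv h \<otimes> inv g))))))"
      using g h uW vW W qW
      by (simp add: q_def val_append val_word_inv x InlI InrI)
    have "val g w = g \<otimes> (val g u \<otimes> val g q)"
      using g closed h n int_pow_mult[OF g, of 1 n] pq
      by (simp add: w_def val_q m_assoc add.commute)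
    \<comment> \<open>If one entry of the commutator is trivial, the other meets its own inverse;
      the outer \<open>g\<close> and \<open>inv g\<close> then cancel as well.\<close>
    also have "\<dots> = \<one>"
      using 1 closed g h by (auto simp: val_q m_assoc[symmetric]) (simp_all add: m_assoc)
    finally show ?thesis .
  qed
  ultimately show ?thesis by blast
qed

text \<open>Induction on the depth \<open>d\<close> of the commutator tree: halve \<open>A\<close>
  and combine the words of the two halves. The summand 2 makes the recursion homogeneous, since
  \<open>2 * cost u + 2 * cost v + 6 + 2\<close> equals
  \<open>2 * (cost u + 2) + 2 * (cost v + 2)\<close>. Each level thus costs a factor 4, starting
  from \<open>2 * n + 4 + 2\<close> at a leaf.\<close>

lemma x_framed_vanishing_on:
  assumes h: "h \<in> carrier G" "h \<noteq> \<one>" "len h \<le> 1"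
  shows "finite A \<Longrightarrow> A \<subseteq> {g \<in> carrier G. len g \<le> n} \<Longrightarrow> card A \<le> 2 ^ d \<Longrightarrow>
    \<exists>u. x_framed u \<and> cost u + 2 \<le> 4 ^ d * (2 * n + 6) \<and> (\<forall>g\<in>A. val g u = \<one>)"
proof (induction d arbitrary: A)
  case 0
  show ?case
  proof (cases "A = {}")
    case True
    \<comment> \<open>Halving a singleton leaves an empty half; the word for \<open>\<one>\<close>,
      of cost at most 4, fills such a leaf.\<close>
    then show ?thesis using x_framed_vanishing_at[OF one_closed] by (auto simp: len_one)
  next
    case False
    then have "card A = 1" using 0 by (simp add: le_Suc_eq)
    then obtain g where "A = {g}" by (rule card_1_singletonE)
    then show ?thesis using x_framed_vanishing_at[of g] 0 by force
  qed
next
  case (Suc d)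
  obtain B where B: "B \<subseteq> A" "card B = card A div 2"
    by (rule obtain_subset_with_card_n[of "card A div 2" A]) auto
  then have "card (A - B) = card A - card A div 2"
    using Suc.prems(1) by (simp add: card_Diff_subset finite_subset)
  then have "card B \<le> 2 ^ d" "card (A - B) \<le> 2 ^ d"
    using B Suc.prems(3) by auto
  then obtain u v
    where u: "x_framed u" "cost u + 2 \<le> 4 ^ d * (2 * n + 6)" "\<forall>g\<in>B. val g u = \<one>"
      and v: "x_framed v" "cost v + 2 \<le> 4 ^ d * (2 * n + 6)" "\<forall>g\<in>A - B. val g v = \<one>"
    using Suc.IH[of B] Suc.IH[of "A - B"] B(1) Suc.prems(1,2) finite_subset by blast
  obtain w where w: "x_framed w" "cost w \<le> 2 * cost u + 2 * cost v + 6"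
    "\<forall>g\<in>carrier G. val g u = \<one> \<or> val g v = \<one> \<longrightarrow> val g w = \<one>"
    using x_framed_commutator[OF u(1) v(1) h] by blast
  have "cost w + 2 \<le> 4 ^ Suc d * (2 * n + 6)" using u(2) v(2) w(2) by simp
  moreover have "\<forall>g\<in>A. val g w = \<one>" using u(3) v(3) w(3) Suc.prems(2) by blast
  ultimately show ?case using w(1) by blast
qed


section \<open>The growth function\<close>

lemma mixed_identity_freeE:
  assumes "mixed_identity_free G" "w \<in> carrier P" "w \<noteq> \<one>\<^bsub>P\<^esub>"
  obtains g where "g \<in> carrier G" "subst_x G w g \<noteq> \<one>"
  using assms by (auto simp: mixed_identity_free_def mixed_identity_def)

text \<open>If all generators were trivial, so would be the group, and x would be a mixed identity.
  The generator found here serves as the conjugator \<open>h\<close> of length at most 1 in the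
  commutators.\<close>

lemma ex_nontrivial_gen:
  assumes "mixed_identity_free G"
  obtains h where "h \<in> S" "h \<noteq> \<one>"
proof -
  have "indet G \<in> carrier P"
    using generate_MIF_gens(1)[OF gens_closed generate_gens] by (simp add: MIF_gens_def)
  then obtain g where g: "g \<in> carrier G" "subst_x G (indet G) g \<noteq> \<one>"
    using mixed_identity_freeE[OF assms] indet_nontrivial by blast
  have "generate G S \<noteq> {\<one>}"
    using g generate_gens subst_x_hom(3) by auto
  then have "\<not> S \<subseteq> {\<one>}"
    using generate_subgroup_incl[OF _ triv_subgroup] generate.one[of G S] by blast
  then show ?thesis using that by blast
qed

text \<open>Any element detecting \<open>u\<close> lies outside the ball where \<open>u\<close>
  vanishes, so the complexity of its class is at least \<open>m\<close>; by the cost bound that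
  class competes in the maximum defining \<open>MIF_growth G S l\<close>.\<close>

lemma MIF_growth_ge:
  assumes mif: "mixed_identity_free G" and fin: "finite S"
    and u: "reduced u" "u \<noteq> []" "cost u \<le> l"
    and van: "\<And>g. g \<in> carrier G \<Longrightarrow> len g < m \<Longrightarrow> val g u = \<one>"
  shows "m \<le> MIF_growth G S l"
proof -
  define w where "w = R `` {u}"
  have w: "w \<in> carrier P" "w \<noteq> \<one>\<^bsub>P\<^esub>"
    using u class_in_carrier reduced_words reduced_nontrivial by (auto simp: w_def)
  \<comment> \<open>Freeness from mixed identities ensures that the \<open>LEAST\<close> in
    \<open>complexity\<close> is attained.\<close>
  have "\<exists>n. \<exists>g\<in>carrier G. subst_x G w g \<noteq> \<one> \<and> len g = n"
    using mixed_identity_freeE[OF mif w] by metis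
  then have "\<exists>g\<in>carrier G. subst_x G w g \<noteq> \<one> \<and> len g = complexity G S w"
    unfolding complexity_def by (rule LeastI_ex)
  then obtain g where "g \<in> carrier G" "val g u \<noteq> \<one>" "len g = complexity G S w"
    using subst_x_class reduced_words u by (auto simp: w_def)
  then have "m \<le> complexity G S w" using van by force
  also have "complexity G S w \<le> MIF_growth G S l"
    unfolding MIF_growth_def setcompr_eq_image
    using MIF_ball(1)[OF gens_closed fin generate_gens, of l] w
      word_length_class_le_cost[OF reduced_words[OF u(1)]] u(3)
    by (intro Max_ge) (auto simp: w_def)
  finally show ?thesis .
qed

text \<open>The witness is x, which vanishes at \<open>\<one>\<close>, the only element of length 0.
  The bound covers small \<open>l\<close>, where the logarithmic estimate gives only 0.\<close>

lemma one_le_MIF_growth: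
  assumes "mixed_identity_free G" "finite S" "l \<ge> 1"
  shows "1 \<le> MIF_growth G S l"
proof (rule MIF_growth_ge[OF assms(1,2)])
  show "reduced [Inr 1]" by (simp add: reduced_Cons_iff reduced_Nil InrI)
  show "cost [Inr 1] \<le> l" using assms(3) by simp
  show "val g [Inr 1] = \<one>" if "g \<in> carrier G" "len g < 1" for g
    using that len_eq_0 by simp
qed simp

text \<open>The logarithmic bound in discrete form: length \<open>D ^ m\<close> suffices for
  complexity \<open>m\<close>.\<close>

lemma MIF_growth_log:
  assumes mif: "mixed_identity_free G" and fin: "finite S"
  obtains D :: nat where "D \<ge> 2" "\<And>m l. D ^ m \<le> l \<Longrightarrow> m \<le> MIF_growth G S l"
proof -
  obtain h where h: "h \<in> S" "h \<noteq> \<one>" using ex_nontrivial_gen[OF mif] .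
  define k where "k = card gen_letters"
  \<comment> \<open>The ball of radius \<open>n\<close> has at most \<open>2 ^ (k * n)\<close>
    elements because \<open>k + 1 \<le> 2 ^ k\<close>, so depth \<open>k * n\<close> suffices. The
    factor \<open>4 ^ k\<close> pays for the tree and 8 for the leaf cost
    \<open>2 * n + 6\<close>.\<close>
  define D :: nat where "D = 8 * 4 ^ k"
  have "m \<le> MIF_growth G S l" if l: "D ^ m \<le> l" for m l
  proof (cases m)
    \<comment> \<open>With \<open>m = n + 1\<close>, vanishing on the ball of radius
      \<open>n\<close> means vanishing at all elements of length below \<open>m\<close>.\<close>
    case (Suc n)
    have "card {g \<in> carrier G. len g \<le> n} \<le> (k + 1) ^ n"
      unfolding k_def by (rule card_ball(2)[OF fin])
    also have "\<dots> \<le> (2 ^ k) ^ n"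
      by (intro power_mono) (auto simp: Suc_leI)
    finally have "card {g \<in> carrier G. len g \<le> n} \<le> 2 ^ (k * n)"
      by (simp add: power_mult)
    then obtain u where u: "x_framed u" "cost u + 2 \<le> 4 ^ (k * n) * (2 * n + 6)"
      "\<forall>g\<in>{g \<in> carrier G. len g \<le> n}. val g u = \<one>"
      using x_framed_vanishing_on[OF _ h(2) len_gen[OF h(1)] card_ball(1)[OF fin] subset_refl]
        gens_closed h(1) by blast
    have "2 * n + 6 \<le> 8 ^ m" unfolding Suc by (induction n) auto
    moreover have "(4::nat) ^ (k * n) \<le> (4 ^ k) ^ m"
      unfolding Suc power_mult[symmetric] by (intro power_increasing) auto
    ultimately have "4 ^ (k * n) * (2 * n + 6) \<le> (4 ^ k) ^ m * 8 ^ m"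
      by (intro mult_mono) auto
    also have "\<dots> = D ^ m" by (simp add: D_def power_mult_distrib)
    finally have "cost u \<le> l" using u(2) l by simp
    then show ?thesis
      using u x_framedD[OF u(1)] Suc by (intro MIF_growth_ge[OF mif fin, of u]) auto
  qed simp
  moreover have "D \<ge> 2" using one_le_power[of "4::nat" k] by (simp add: D_def)
  ultimately show ?thesis using that by blast
qed

end

theorem theorem1p9:
  fixes G :: "('a, 'm) monoid_scheme" and S :: "'a set"
  assumes "group G"
    and "mixed_identity_free G"
    and "finite S" and "S \<subseteq> carrier G" and "generate G S = carrier G"
  shows "\<not> (\<exists>B. \<forall>l\<ge>1. MIF_growth G S l \<le> B) \<and>
    (\<exists>c>0. \<forall>l\<ge>1. real (MIF_growth G S l) \<ge> c * ln (real l))"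
proof -
  interpret marked_group G S
    using assms by (intro marked_group.intro marked_group_axioms.intro)
  obtain D :: nat where D: "D \<ge> 2" "\<And>m l. D ^ m \<le> l \<Longrightarrow> m \<le> MIF_growth G S l"
    using MIF_growth_log[OF assms(2,3)] by blast
  have "\<not> (\<exists>B. \<forall>l\<ge>1. MIF_growth G S l \<le> B)"
  proof
    assume "\<exists>B. \<forall>l\<ge>1. MIF_growth G S l \<le> B"
    then obtain B where "\<forall>l\<ge>1. MIF_growth G S l \<le> B" by blast
    then have "MIF_growth G S (D ^ Suc B) \<le> B" using D(1) one_le_power[of D "Suc B"] by simp
    then show False using D(2)[of "Suc B", OF order_refl] by simp
  qed
  \<comment> \<open>With \<open>n\<close> the integer part of the logarithm of \<open>l\<close> to
    base \<open>D\<close>, \<open>ln l\<close> is at most \<open>(n + 1) * ln D\<close>. The growth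
    is at least both \<open>n\<close> and 1, hence at least half of \<open>n + 1\<close>, which
    gives the factor 2 in the constant.\<close>
  moreover have "real (MIF_growth G S l) \<ge> 1 / (2 * ln D) * ln l" if l: "l \<ge> 1" for l
  proof -
    obtain n where n: "D ^ n \<le> l" "l < D ^ (n + 1)"
      using ex_power_ivl1[OF D(1) l] by blast
    have "n + 1 \<le> 2 * MIF_growth G S l"
      using D(2)[OF n(1)] one_le_MIF_growth[OF assms(2,3) l] by linarith
    then have growth: "real (n + 1) \<le> 2 * MIF_growth G S l" by linarith
    have "ln D > 0" using D(1) by simp
    have "real l \<le> real D ^ (n + 1)"
      using n(2) by (metis less_imp_le of_nat_le_iff of_nat_power)
    then have "ln l \<le> ln (real D ^ (n + 1))"
      using l by (subst ln_le_cancel_iff) auto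
    also have "\<dots> = (n + 1) * ln D"
      using D(1) by (subst ln_realpow) auto
    also have "\<dots> \<le> 2 * MIF_growth G S l * ln D"
      using growth \<open>ln D > 0\<close> by (intro mult_right_mono) auto
    finally show ?thesis using \<open>ln D > 0\<close> by (simp add: field_simps)
  qed
  moreover have "1 / (2 * ln D) > 0" using D(1) by simp
  ultimately show ?thesis by blast
qed

end
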